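(* Let $\mathscr H$ be a complex Hilbert space, let $\mathfrak M$ be a nonempty set of bounded self-adjoint operators on $\mathscr H$ that is bounded from below, and let $\mathfrak L$ be the set of all its lower bounds. Let $u\in\mathscr H$ be a unit vector and set $$\alpha:=\inf\{(Au,u):A\in\mathfrak M\},\quad \mathfrak M_u:=\{A\in\mathfrak M:(Au,u)=\alpha\},\quad \mathfrak L_u:=\{L\in\mathfrak L:(Lu,u)=\alpha\}.$$ Suppose that $\mathfrak M_u$ is not empty and that $Au=Bu$ for all $A,B\in\mathfrak M_u$. For $B=\begin{pmatrix}\alpha & B_{12} \\ B_{12}^{*} & B_2\end{pmatrix}\in\mathfrak M_u$ define $$\mathfrak M':=\bigl\{A_2-(a_1-\alpha)^{\#}(A_{12}-B_{12})^{*}(A_{12}-B_{12}) : A\in\mathfrak M\bigr\},$$ which does not depend on the choice of $B\in\mathfrak M_u$. Let $M$ be a lower bound of $\mathfrak M$. The following assertions are equivalent: (i) $M$ is a maximal element of $\mathfrak L_u$; (ii) $M$ is a maximal element of $\mathfrak L$ and satisfies $(Mu,u)=\alpha$; (iii) $M$ has a block operator representation $M=\begin{pmatrix}\alpha & B_{12} \\ B_{12}^{*} & M_2\end{pmatrix}$, where $\begin{pmatrix}\alpha & B_{12} \\ B_{12}^{*} & B_2\end{pmatrix}\in\mathfrak M_u$ and $M_2$ is a maximal lower bound of $\mathfrak M'$.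
   Context: Bounded self-adjoint operators are ordered by Löwner's order: $S\le T$ iff $(Sv,v)\le (Tv,v)$ for all vectors $v$. A self-adjoint operator $L$ is a lower bound of a set $\mathfrak M$ of bounded self-adjoint operators if $L\le A$ for all $A\in\mathfrak M$; $\mathfrak M$ is bounded from below if it has a lower bound. An element $M$ of a partially ordered set $\mathfrak L$ is maximal if $L\in\mathfrak L$ and $M\le L$ imply $L=M$; a maximal lower bound is a maximal element of the set of all lower bounds. Let $\mathscr H_1=\mathbb C u$ and $\mathscr H_2=\mathscr H_1^{\perp}$. Every bounded self-adjoint $S$ on $\mathscr H$ is written in block form $S=\begin{pmatrix}s_1 & S_{12} \\ S_{12}^{*} & S_2\end{pmatrix}$ with respect to $\mathscr H=\mathscr H_1\oplus\mathscr H_2$, where $s_1=(Su,u)$ is a real number, $S_{12}:\mathscr H_2\to\mathscr H_1$, and $S_2$ is bounded self-adjoint on $\mathscr H_2$; for $A\in\mathfrak M$ the blocks are $a_1,A_{12},A_2$. For a real number $t$, $t^{\#}=t^{-1}$ if $t\neq0$ and $0^{\#}=0$. Lower bounds of $\mathfrak M'$ are taken among bounded self-adjoint operators on $\mathscr H_2$. *)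

theory Defs
  imports "HOL-Analysis.Analysis"
begin

text \<open>
  Complex Hilbert spaces: real Banach spaces with a compatible complex scalar multiplication and
  a complex inner product, linear in the first argument, that induces the norm.
\<close>

class complex_hilbert_space = banach +
  fixes scaleC :: "complex \<Rightarrow> 'a \<Rightarrow> 'a"  (infixr "*\<^sub>C" 75)
    and cinner :: "'a \<Rightarrow> 'a \<Rightarrow> complex"
  assumes scaleC_add_right: "c *\<^sub>C (x + y) = c *\<^sub>C x + c *\<^sub>C y"
    and scaleC_add_left: "(c + d) *\<^sub>C x = c *\<^sub>C x + d *\<^sub>C x"
    and scaleC_scaleC: "c *\<^sub>C d *\<^sub>C x = (c * d) *\<^sub>C x"
    and scaleC_one: "1 *\<^sub>C x = x"
    and scaleR_scaleC: "r *\<^sub>R x = complex_of_real r *\<^sub>C x"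
    and cinner_commute: "cinner x y = cnj (cinner y x)"
    and cinner_add_left: "cinner (x + y) z = cinner x z + cinner y z"
    and cinner_scaleC_left: "cinner (c *\<^sub>C x) y = c * cinner x y"
    and cinner_ge_zero: "0 \<le> Re (cinner x x)"
    and cinner_eq_zero_iff: "cinner x x = 0 \<longleftrightarrow> x = 0"
    and norm_eq_sqrt_cinner: "norm x = sqrt (Re (cinner x x))"

instantiation complex :: complex_hilbert_space
begin
definition scaleC_complex :: "complex \<Rightarrow> complex \<Rightarrow> complex" where "scaleC_complex c x = c * x"
definition cinner_complex :: "complex \<Rightarrow> complex \<Rightarrow> complex" where "cinner_complex x y = x * cnj y"
instance
proof
  fix c d x y z :: complex and r :: real
  show "c *\<^sub>C (x + y) = c *\<^sub>C x + c *\<^sub>C y"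
    by (simp add: scaleC_complex_def distrib_left)
  show "(c + d) *\<^sub>C x = c *\<^sub>C x + d *\<^sub>C x"
    by (simp add: scaleC_complex_def distrib_right)
  show "c *\<^sub>C d *\<^sub>C x = (c * d) *\<^sub>C x" "1 *\<^sub>C x = x"
    by (simp_all add: scaleC_complex_def)
  show "r *\<^sub>R x = complex_of_real r *\<^sub>C x"
    by (simp add: scaleC_complex_def scaleR_conv_of_real)
  show "cinner x y = cnj (cinner y x)"
    by (simp add: cinner_complex_def)
  show "cinner (x + y) z = cinner x z + cinner y z"
    by (simp add: cinner_complex_def distrib_right)
  show "cinner (c *\<^sub>C x) y = c * cinner x y"
    by (simp add: cinner_complex_def scaleC_complex_def)
  show "0 \<le> Re (cinner x x)" "cinner x x = 0 \<longleftrightarrow> x = 0"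
    by (simp_all add: cinner_complex_def)
  show "norm x = sqrt (Re (cinner x x))"
    by (simp add: cinner_complex_def cmod_def power2_eq_square)
qed
end

definition cline :: "'a::complex_hilbert_space \<Rightarrow> 'a set" where
  "cline u = range (\<lambda>c. c *\<^sub>C u)"

definition orth_compl :: "'a::complex_hilbert_space set \<Rightarrow> 'a set" where
  "orth_compl V = {x. \<forall>y\<in>V. cinner x y = 0}"

definition orth_proj :: "'a::complex_hilbert_space set \<Rightarrow> 'a \<Rightarrow> 'a" where
  "orth_proj V x = (THE y. y \<in> V \<and> x - y \<in> orth_compl V)"

text \<open>
  Operators between closed subspaces \<open>V\<close> and \<open>W\<close> are functions on the ambient space that are
  \<^const>\<open>undefined\<close> outside \<open>V\<close>, so that equality of functions is equality of operators.
  For \<open>V = UNIV\<close> this is no restriction.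
\<close>

definition bounded_op :: "'a::complex_hilbert_space set \<Rightarrow> 'a set \<Rightarrow> ('a \<Rightarrow> 'a) set" where
  "bounded_op V W = {T \<in> V \<rightarrow>\<^sub>E W.
     (\<forall>x\<in>V. \<forall>y\<in>V. T (x + y) = T x + T y) \<and>
     (\<forall>c. \<forall>x\<in>V. T (c *\<^sub>C x) = c *\<^sub>C T x) \<and>
     (\<exists>K. \<forall>x\<in>V. norm (T x) \<le> K * norm x)}"

definition adjoint_op ::
    "'a::complex_hilbert_space set \<Rightarrow> 'a set \<Rightarrow> ('a \<Rightarrow> 'a) \<Rightarrow> 'a \<Rightarrow> 'a" where
  "adjoint_op V W T =
     restrict (\<lambda>y. THE z. z \<in> V \<and> (\<forall>x\<in>V. cinner (T x) y = cinner x z)) W"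

definition selfadjoint_op :: "'a::complex_hilbert_space set \<Rightarrow> ('a \<Rightarrow> 'a) set" where
  "selfadjoint_op V = {T \<in> bounded_op V V. \<forall>x\<in>V. \<forall>y\<in>V. cinner (T x) y = cinner x (T y)}"

text \<open>For self-adjoint \<open>S\<close>, \<open>cinner (S v) v\<close> is real, so taking the real part loses nothing.\<close>

definition qform :: "('a::complex_hilbert_space \<Rightarrow> 'a) \<Rightarrow> 'a \<Rightarrow> real" where
  "qform S v = Re (cinner (S v) v)"

definition loewner_le ::
    "'a::complex_hilbert_space set \<Rightarrow> ('a \<Rightarrow> 'a) \<Rightarrow> ('a \<Rightarrow> 'a) \<Rightarrow> bool" where
  "loewner_le V S T \<longleftrightarrow> (\<forall>v\<in>V. qform S v \<le> qform T v)"

definition lower_bounds ::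
    "'a::complex_hilbert_space set \<Rightarrow> ('a \<Rightarrow> 'a) set \<Rightarrow> ('a \<Rightarrow> 'a) set" where
  "lower_bounds V \<MM> = {L \<in> selfadjoint_op V. \<forall>A\<in>\<MM>. loewner_le V L A}"

definition is_maximal ::
    "'a::complex_hilbert_space set \<Rightarrow> ('a \<Rightarrow> 'a) set \<Rightarrow> ('a \<Rightarrow> 'a) \<Rightarrow> bool" where
  "is_maximal V \<LL> M \<longleftrightarrow> M \<in> \<LL> \<and> (\<forall>L\<in>\<LL>. loewner_le V M L \<longrightarrow> L = M)"

definition compression ::
    "'a::complex_hilbert_space set \<Rightarrow> 'a set \<Rightarrow> ('a \<Rightarrow> 'a) \<Rightarrow> 'a \<Rightarrow> 'a" where
  "compression V W S = restrict (\<lambda>x. orth_proj W (S x)) V"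

text \<open>
  Blocks with respect to \<open>cline u\<close> and its orthogonal complement, for a unit vector \<open>u\<close>. The
  upper left block is identified with the real number \<open>qform S u\<close>.
\<close>

abbreviation uperp :: "'a::complex_hilbert_space \<Rightarrow> 'a set" where
  "uperp u \<equiv> orth_compl (cline u)"

definition block12 :: "'a::complex_hilbert_space \<Rightarrow> ('a \<Rightarrow> 'a) \<Rightarrow> 'a \<Rightarrow> 'a" where
  "block12 u S = compression (uperp u) (cline u) S"

definition block22 :: "'a::complex_hilbert_space \<Rightarrow> ('a \<Rightarrow> 'a) \<Rightarrow> 'a \<Rightarrow> 'a" where
  "block22 u S = compression (uperp u) (uperp u) S"

definition block_matrix ::
    "'a::complex_hilbert_space \<Rightarrow> real \<Rightarrow> ('a \<Rightarrow> 'a) \<Rightarrow> ('a \<Rightarrow> 'a) \<Rightarrow> 'a \<Rightarrow> 'a" where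
  "block_matrix u s S12 S2 = (\<lambda>x.
     let x1 = orth_proj (cline u) x; x2 = orth_proj (uperp u) x
     in (s *\<^sub>R x1 + S12 x2) + (adjoint_op (uperp u) (cline u) S12 x1 + S2 x2))"

definition sharp :: "real \<Rightarrow> real" where
  "sharp t = (if t = 0 then 0 else inverse t)"

definition qinf :: "('a::complex_hilbert_space \<Rightarrow> 'a) set \<Rightarrow> 'a \<Rightarrow> real" where
  "qinf \<MM> u = (INF A\<in>\<MM>. qform A u)"

definition attaining :: "('a::complex_hilbert_space \<Rightarrow> 'a) set \<Rightarrow> 'a \<Rightarrow> ('a \<Rightarrow> 'a) set" where
  "attaining \<MM> u = {A \<in> \<MM>. qform A u = qinf \<MM> u}"

definition lower_bounds_attaining ::
    "('a::complex_hilbert_space \<Rightarrow> 'a) set \<Rightarrow> 'a \<Rightarrow> ('a \<Rightarrow> 'a) set" where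
  "lower_bounds_attaining \<MM> u = {L \<in> lower_bounds UNIV \<MM>. qform L u = qinf \<MM> u}"

text \<open>
  The set of operators
  \<open>A2 - (a1 - \<alpha>)\<^sup># (A12 - B12)\<^sup>* (A12 - B12)\<close>, \<open>A \<in> \<MM>\<close>, on the orthogonal
  complement of \<open>u\<close>.
\<close>

definition schur_family ::
    "('a::complex_hilbert_space \<Rightarrow> 'a) set \<Rightarrow> 'a \<Rightarrow> ('a \<Rightarrow> 'a) \<Rightarrow> ('a \<Rightarrow> 'a) set" where
  "schur_family \<MM> u B =
     (\<lambda>A. let D = restrict (\<lambda>x. block12 u A x - block12 u B x) (uperp u)
          in restrict (\<lambda>x. block22 u A x -
               sharp (qform A u - qinf \<MM> u) *\<^sub>R adjoint_op (uperp u) (cline u) D (D x))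
             (uperp u)) ` \<MM>"

end

theory Submission
  imports Defs
begin

text \<open>
  Write \<open>\<alpha>\<close> for the infimum of \<open>(A u, u)\<close>. The proof replaces the order on operators with
  prescribed first column by the order on their lower right blocks.

  A lower bound \<open>L\<close> with \<open>(L u, u) = \<alpha>\<close> lies below \<open>B\<close>, and the positive form of \<open>B - L\<close>
  vanishes at \<open>u\<close>; hence \<open>L u = B u\<close> (\<open>positive_form_zero\<close>). So all such \<open>L\<close> have the same
  first row and column as \<open>B\<close>, and only the block \<open>L\<^sub>2\<close> on the orthogonal complement of \<open>u\<close> is
  free. For \<open>A \<in> \<MM>\<close> the difference \<open>A - L\<close> has the nonnegative corner
  \<open>a\<^sub>1 - \<alpha>\<close>. When that corner is \<open>0\<close>, the whole first column \<open>A u - B u\<close> is \<open>0\<close> by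
  hypothesis, so completing the square (\<open>positive_iff_schur\<close>) shows that \<open>L \<le> A\<close> holds iff
  \<open>L\<^sub>2\<close> lies below the Schur complement of \<open>A\<close> that enters \<open>\<MM>'\<close>. Therefore \<open>L \<mapsto> L\<^sub>2\<close> is an
  order isomorphism from \<open>\<LL>\<^sub>u\<close> onto the set of lower bounds of \<open>\<MM>'\<close>
  (\<open>lower_bound_iff_block22\<close>, \<open>loewner_le_iff_block22\<close>, and \<open>block22_lift\<close> for surjectivity),
  and it carries maximal elements to maximal elements.

  That maximality in \<open>\<LL>\<^sub>u\<close> and in \<open>\<LL>\<close> agree is the remark that a lower bound \<open>L\<close> above
  an element of \<open>\<LL>\<^sub>u\<close> has \<open>(L u, u)\<close> squeezed between \<open>\<alpha>\<close> and \<open>(B u, u) = \<alpha>\<close>.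

  Adjoints of the off-diagonal blocks come without the Riesz representation theorem: a
  self-adjoint \<open>S\<close> gives \<open>(S y, u) = (y, S u)\<close>, so the representing vector is the component of
  \<open>S u\<close> orthogonal to \<open>u\<close>.
\<close>

section \<open>Complex inner products\<close>

interpretation cscale: module "scaleC :: complex \<Rightarrow> 'a::complex_hilbert_space \<Rightarrow> 'a"
  by unfold_locales
    (simp_all add: scaleC_add_right scaleC_add_left scaleC_scaleC scaleC_one)

lemma cinner_add_right: "cinner x (y + z) = cinner x y + cinner x z"
  by (metis cinner_add_left cinner_commute complex_cnj_add)

lemma cinner_scaleC_right: "cinner x (c *\<^sub>C y) = cnj c * cinner x y"
  by (metis cinner_scaleC_left cinner_commute complex_cnj_mult)

lemma cinner_zero_left [simp]: "cinner 0 x = 0"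
  using cinner_scaleC_left[of 0 0 x] by simp

lemma cinner_zero_right [simp]: "cinner x 0 = 0"
  using cinner_scaleC_right[of x 0 0] by simp

lemma cinner_diff_left: "cinner (x - y) z = cinner x z - cinner y z"
  using cinner_add_left[of "x - y" y z] by simp

lemma cinner_diff_right: "cinner x (y - z) = cinner x y - cinner x z"
  using cinner_add_right[of x "y - z" z] by simp

lemmas cinner_linear =
  cinner_add_left cinner_add_right cinner_diff_left cinner_diff_right
  cinner_scaleC_left cinner_scaleC_right

lemma cinner_self: "cinner x x = complex_of_real ((norm x)\<^sup>2)"
proof -
  have "Im (cinner x x) = 0"
    using arg_cong[OF cinner_commute[of x x], of Im] by simp
  moreover have "Re (cinner x x) = (norm x)\<^sup>2"
    by (simp add: norm_eq_sqrt_cinner cinner_ge_zero)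
  ultimately show ?thesis
    by (simp add: complex_eq_iff)
qed

lemma cinner_unit: "norm u = 1 \<Longrightarrow> cinner u u = 1"
  by (simp add: cinner_self)

lemma norm_pythagoras:
  assumes "cinner x y = 0"
  shows "(norm (x + y))\<^sup>2 = (norm x)\<^sup>2 + (norm y)\<^sup>2"
proof -
  have "cinner y x = 0"
    using assms cinner_commute[of y x] by simp
  then have "complex_of_real ((norm (x + y))\<^sup>2) = complex_of_real ((norm x)\<^sup>2 + (norm y)\<^sup>2)"
    unfolding of_real_add cinner_self[symmetric] using assms by (simp add: cinner_linear)
  then show ?thesis
    using of_real_eq_iff by blast
qed

section \<open>Projections onto a line and its complement\<close>

lemma mem_uperp: "x \<in> uperp u \<longleftrightarrow> cinner x u = 0"
proof -
  have "u \<in> cline u"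
    using scaleC_one[of u] by (metis cline_def rangeI)
  then show ?thesis
    by (auto simp: orth_compl_def cline_def cinner_scaleC_right)
qed

lemma orth_proj_eqI:
  assumes y: "y \<in> V" "x - y \<in> orth_compl V"
    and diff: "\<And>a b. a \<in> V \<Longrightarrow> b \<in> V \<Longrightarrow> a - b \<in> V"
  shows "orth_proj V x = y"
  unfolding orth_proj_def
proof (rule the_equality)
  fix z assume z: "z \<in> V \<and> x - z \<in> orth_compl V"
  then have "z - y \<in> V"
    using y diff by blast
  then have "cinner (x - y) (z - y) = 0" "cinner (x - z) (z - y) = 0"
    using y z by (auto simp: orth_compl_def)
  then have "cinner (z - y) (z - y) = 0"
    by (simp add: cinner_diff_left)
  then show "z = y"
    by (simp add: cinner_eq_zero_iff)
qed (use y in blast)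

lemma adjoint_op_eqI:
  assumes "y \<in> W" "z \<in> V" "\<And>x. x \<in> V \<Longrightarrow> cinner (T x) y = cinner x z"
    and diff: "\<And>a b. a \<in> V \<Longrightarrow> b \<in> V \<Longrightarrow> a - b \<in> V"
  shows "adjoint_op V W T y = z"
proof -
  have "(THE z. z \<in> V \<and> (\<forall>x\<in>V. cinner (T x) y = cinner x z)) = z"
  proof (rule the_equality)
    fix z' assume z': "z' \<in> V \<and> (\<forall>x\<in>V. cinner (T x) y = cinner x z')"
    then have "z' - z \<in> V"
      using assms by blast
    then have "cinner (z' - z) z' = cinner (z' - z) z"
      using z' assms(3) by metis
    then have "cinner (z' - z) (z' - z) = 0"
      by (simp add: cinner_diff_right)
    then show "z' = z"
      by (simp add: cinner_eq_zero_iff)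
  qed (use assms in blast)
  then show ?thesis
    using assms(1) by (simp add: adjoint_op_def)
qed

lemma uperp_diff: "a \<in> uperp u \<Longrightarrow> b \<in> uperp u \<Longrightarrow> a - b \<in> uperp u"
  by (simp add: mem_uperp cinner_diff_left)

lemma orth_proj_cline:
  assumes "norm u = 1"
  shows "orth_proj (cline u) x = cinner x u *\<^sub>C u"
proof (rule orth_proj_eqI)
  show "x - cinner x u *\<^sub>C u \<in> uperp u"
    using assms by (simp add: mem_uperp cinner_linear cinner_unit)
  show "a - b \<in> cline u" if "a \<in> cline u" "b \<in> cline u" for a b
    using that by (auto simp: cline_def cscale.scale_left_diff_distrib[symmetric])
qed (simp add: cline_def)

lemma orth_proj_uperp:
  assumes "norm u = 1"
  shows "orth_proj (uperp u) x = x - cinner x u *\<^sub>C u"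
proof (rule orth_proj_eqI)
  show "x - cinner x u *\<^sub>C u \<in> uperp u"
    using assms by (simp add: mem_uperp cinner_linear cinner_unit)
  have "cinner u y = 0" if "y \<in> uperp u" for y
    using that cinner_commute[of u y] by (simp add: mem_uperp)
  then show "x - (x - cinner x u *\<^sub>C u) \<in> orth_compl (uperp u)"
    by (auto simp: orth_compl_def cinner_scaleC_left)
qed (rule uperp_diff)

lemma orth_proj_uperp_mem: "norm u = 1 \<Longrightarrow> orth_proj (uperp u) x \<in> uperp u"
  by (simp add: orth_proj_uperp mem_uperp cinner_linear cinner_unit)

lemma orth_proj_uperp_id: "norm u = 1 \<Longrightarrow> y \<in> uperp u \<Longrightarrow> orth_proj (uperp u) y = y"
  by (simp add: orth_proj_uperp mem_uperp)

lemma orth_decomp: "norm u = 1 \<Longrightarrow> x = cinner x u *\<^sub>C u + orth_proj (uperp u) x"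
  by (simp add: orth_proj_uperp)

lemma cinner_uperp_left: "y \<in> uperp u \<Longrightarrow> cinner u y = 0"
  using cinner_commute[of u y] by (simp add: mem_uperp)

lemma cinner_orth_proj_right:
  "norm u = 1 \<Longrightarrow> y \<in> uperp u \<Longrightarrow> cinner y (orth_proj (uperp u) x) = cinner y x"
  by (simp add: orth_proj_uperp cinner_linear mem_uperp)

lemma cinner_orth_proj_left:
  "norm u = 1 \<Longrightarrow> y \<in> uperp u \<Longrightarrow> cinner (orth_proj (uperp u) x) y = cinner x y"
  by (simp add: orth_proj_uperp cinner_linear cinner_uperp_left)

lemma norm_components_le:
  assumes "norm u = 1"
  shows "norm (cinner x u *\<^sub>C u) \<le> norm x" "norm (orth_proj (uperp u) x) \<le> norm x"
proof -
  let ?c = "cinner x u *\<^sub>C u" and ?p = "orth_proj (uperp u) x"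
  have "cinner ?c ?p = 0"
    using assms by (simp add: cinner_scaleC_left cinner_uperp_left orth_proj_uperp_mem)
  then have "(norm x)\<^sup>2 = (norm ?c)\<^sup>2 + (norm ?p)\<^sup>2"
    using norm_pythagoras orth_decomp[OF assms] by metis
  then have "(norm ?c)\<^sup>2 \<le> (norm x)\<^sup>2" "(norm ?p)\<^sup>2 \<le> (norm x)\<^sup>2"
    by simp_all
  then show "norm ?c \<le> norm x" "norm ?p \<le> norm x"
    by (auto intro: power2_le_imp_le)
qed

lemma orth_proj_uperp_add:
  "norm u = 1 \<Longrightarrow> orth_proj (uperp u) (x + y) = orth_proj (uperp u) x + orth_proj (uperp u) y"
  by (simp add: orth_proj_uperp cinner_add_left cscale.scale_left_distrib)

lemma orth_proj_uperp_scaleC: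
  "norm u = 1 \<Longrightarrow> orth_proj (uperp u) (c *\<^sub>C x) = c *\<^sub>C orth_proj (uperp u) x"
  by (simp add: orth_proj_uperp cinner_scaleC_left cscale.scale_right_diff_distrib)

section \<open>Self-adjoint operators and their forms\<close>

lemma
  assumes "S \<in> selfadjoint_op V"
  shows selfadjoint_mem: "x \<in> V \<Longrightarrow> S x \<in> V"
    and selfadjoint_undefined: "x \<notin> V \<Longrightarrow> S x = undefined"
    and selfadjoint_add: "x \<in> V \<Longrightarrow> y \<in> V \<Longrightarrow> S (x + y) = S x + S y"
    and selfadjoint_scaleC: "x \<in> V \<Longrightarrow> S (c *\<^sub>C x) = c *\<^sub>C S x"
    and selfadjoint_sym: "x \<in> V \<Longrightarrow> y \<in> V \<Longrightarrow> cinner (S x) y = cinner x (S y)"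
    and selfadjoint_bounded: "\<exists>K. \<forall>x\<in>V. norm (S x) \<le> K * norm x"
  using assms unfolding selfadjoint_op_def bounded_op_def by (blast dest: PiE_mem PiE_arb)+

lemma selfadjointI:
  assumes "\<And>x. x \<in> V \<Longrightarrow> S x \<in> V" "\<And>x. x \<notin> V \<Longrightarrow> S x = undefined"
    and "\<And>x y. x \<in> V \<Longrightarrow> y \<in> V \<Longrightarrow> S (x + y) = S x + S y"
    and "\<And>c x. x \<in> V \<Longrightarrow> S (c *\<^sub>C x) = c *\<^sub>C S x"
    and "\<And>x y. x \<in> V \<Longrightarrow> y \<in> V \<Longrightarrow> cinner (S x) y = cinner x (S y)"
    and "\<And>x. x \<in> V \<Longrightarrow> norm (S x) \<le> K * norm x"
  shows "S \<in> selfadjoint_op V"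
  unfolding selfadjoint_op_def bounded_op_def
  by (intro CollectI conjI ballI allI exI[of _ K] PiE_I) (fact assms)+

lemma selfadjoint_diff:
  fixes S T :: "'a::complex_hilbert_space \<Rightarrow> 'a"
  assumes "S \<in> selfadjoint_op UNIV" "T \<in> selfadjoint_op UNIV"
  shows "(\<lambda>x. S x - T x) \<in> selfadjoint_op UNIV"
proof -
  obtain K K' where K: "\<And>x. norm (S x) \<le> K * norm x" "\<And>x. norm (T x) \<le> K' * norm x"
    using assms[THEN selfadjoint_bounded] by auto
  show ?thesis
  proof (rule selfadjointI)
    show "norm (S x - T x) \<le> (K + K') * norm x" for x
      using norm_triangle_ineq4[of "S x" "T x"] K[of x] by (simp add: distrib_right)
  qed (use assms in \<open>simp_all add: selfadjoint_add selfadjoint_scaleC selfadjoint_sym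
      cinner_diff_left cinner_diff_right cscale.scale_right_diff_distrib\<close>)
qed

lemma qform_diff: "qform (\<lambda>x. S x - T x) v = qform S v - qform T v"
  by (simp add: qform_def cinner_diff_left)

lemma selfadjoint_cinner_diag:
  assumes "S \<in> selfadjoint_op V" "x \<in> V"
  shows "cinner (S x) x = complex_of_real (qform S x)"
proof -
  have "cinner (S x) x = cnj (cinner (S x) x)"
    using selfadjoint_sym[OF assms assms(2)] cinner_commute by metis
  then have "Im (cinner (S x) x) = 0"
    by (metis Reals_cnj_iff complex_is_Real_iff)
  then show ?thesis
    by (simp add: qform_def complex_eq_iff)
qed

lemma qform_combination:
  fixes E :: "'a::complex_hilbert_space \<Rightarrow> 'a"
  assumes E: "E \<in> selfadjoint_op UNIV"
  shows "qform E (c *\<^sub>C u + y) =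
    (cmod c)\<^sup>2 * qform E u + 2 * Re (cnj c * cinner y (E u)) + qform E y"
proof -
  have "cinner (E u) y = cnj (cinner y (E u))" "cinner (E y) u = cinner y (E u)"
    using cinner_commute[of "E u" y] cinner_commute[of "E y" u] cinner_commute[of u "E y"]
      selfadjoint_sym[OF E, of y u] by simp_all
  then have "cinner (E (c *\<^sub>C u + y)) (c *\<^sub>C u + y) =
      c * cnj c * complex_of_real (qform E u) + c * cnj (cinner y (E u))
      + cnj c * cinner y (E u) + complex_of_real (qform E y)"
    using E by (simp add: selfadjoint_add selfadjoint_scaleC cinner_linear
        selfadjoint_cinner_diag[OF E, symmetric] algebra_simps)
  moreover have "c * cnj c * complex_of_real (qform E u)
      = complex_of_real ((cmod c)\<^sup>2 * qform E u)"
    by (simp only: complex_norm_square of_real_mult)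
  ultimately have "qform E (c *\<^sub>C u + y) = (cmod c)\<^sup>2 * qform E u
      + Re (c * cnj (cinner y (E u))) + Re (cnj c * cinner y (E u)) + qform E y"
    unfolding qform_def[of E "c *\<^sub>C u + y"] by (simp only: plus_complex.sel Re_complex_of_real)
  then show ?thesis
    by simp
qed

text \<open>
  If \<open>E u \<noteq> 0\<close>, the form is affine with nonzero slope along the line \<open>E u + t u\<close>, hence takes
  negative values.
\<close>

lemma positive_form_zero:
  fixes E :: "'a::complex_hilbert_space \<Rightarrow> 'a"
  assumes E: "E \<in> selfadjoint_op UNIV"
    and pos: "\<And>x. 0 \<le> qform E x" and zero: "qform E u = 0"
  shows "E u = 0"
proof (rule ccontr)
  assume "E u \<noteq> 0"
  then have n: "(norm (E u))\<^sup>2 > 0"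
    by simp
  let ?t = "- (qform E (E u) + 1) / (2 * (norm (E u))\<^sup>2)"
  have "qform E (complex_of_real ?t *\<^sub>C u + E u) =
      2 * Re (complex_of_real ?t * complex_of_real ((norm (E u))\<^sup>2)) + qform E (E u)"
    using zero by (simp only: qform_combination[OF E] cinner_self complex_cnj_complex_of_real)
  also have "\<dots> = 2 * (?t * (norm (E u))\<^sup>2) + qform E (E u)"
    by (simp only: of_real_mult[symmetric] Re_complex_of_real)
  also have "\<dots> = - 1"
    using n by (simp add: field_simps)
  finally show False
    using pos[of "complex_of_real ?t *\<^sub>C u + E u"] by simp
qed

text \<open>
  Completing the square: for \<open>e = (E u, u) > 0\<close> and \<open>q = (y, E u)\<close>, the form at \<open>c u + y\<close> is
  \<open>\<bar>e c + q\<bar>\<^sup>2 / e + (E y, y) - \<bar>q\<bar>\<^sup>2 / e\<close>, whose minimum over \<open>c\<close> is attained at \<open>c = - q / e\<close>.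
  For \<open>e = 0\<close> the cross term vanishes with \<open>E u\<close>, and the convention \<open>0\<^sup># = 0\<close> makes the two sides
  agree.
\<close>

lemma positive_iff_schur:
  fixes E :: "'a::complex_hilbert_space \<Rightarrow> 'a"
  assumes u: "norm u = 1" and E: "E \<in> selfadjoint_op UNIV"
    and ge: "0 \<le> qform E u" and degenerate: "qform E u = 0 \<Longrightarrow> E u = 0"
  shows "(\<forall>x. 0 \<le> qform E x) \<longleftrightarrow>
    (\<forall>y\<in>uperp u. sharp (qform E u) * (cmod (cinner y (E u)))\<^sup>2 \<le> qform E y)"
proof (cases "qform E u = 0")
  case True
  have "qform E x = qform E (orth_proj (uperp u) x)" for x
    using qform_combination[OF E, of "cinner x u" u "orth_proj (uperp u) x"]
      orth_decomp[OF u, of x] True degenerate by simp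
  then show ?thesis
    using True orth_proj_uperp_mem[OF u] by (auto simp: sharp_def) metis
next
  case False
  define e where "e = qform E u"
  have e: "e > 0"
    using False ge by (simp add: e_def)
  have square: "qform E (c *\<^sub>C u + y) =
      (cmod (e *\<^sub>R c + cinner y (E u)))\<^sup>2 / e
      + (qform E y - sharp e * (cmod (cinner y (E u)))\<^sup>2)" for c y
  proof -
    have "(cmod (e *\<^sub>R c + cinner y (E u)))\<^sup>2 =
        e\<^sup>2 * (cmod c)\<^sup>2 + 2 * e * Re (cnj c * cinner y (E u)) + (cmod (cinner y (E u)))\<^sup>2"
      by (simp add: cmod_power2) (simp add: power2_eq_square algebra_simps)
    then show ?thesis
      unfolding qform_combination[OF E] e_def[symmetric]
      using e by (simp add: sharp_def field_simps power2_eq_square)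
  qed
  show ?thesis
    unfolding e_def[symmetric]
  proof (intro iffI ballI allI)
    fix y assume pos: "\<forall>x. 0 \<le> qform E x"
    let ?c = "- (cinner y (E u) /\<^sub>R e)"
    have "e *\<^sub>R ?c + cinner y (E u) = 0"
      using e by simp
    then have "qform E (?c *\<^sub>C u + y) = qform E y - sharp e * (cmod (cinner y (E u)))\<^sup>2"
      using square[of ?c y] by (metis norm_zero zero_power2 div_0 add_0)
    then show "sharp e * (cmod (cinner y (E u)))\<^sup>2 \<le> qform E y"
      using pos by (metis diff_ge_0_iff_ge)
  next
    fix x
    assume le: "\<forall>y\<in>uperp u. sharp e * (cmod (cinner y (E u)))\<^sup>2 \<le> qform E y"
    let ?y = "orth_proj (uperp u) x"
    have "0 \<le> qform E (cinner x u *\<^sub>C u + ?y)"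
      unfolding square using le orth_proj_uperp_mem[OF u, of x] e by simp
    then show "0 \<le> qform E x"
      using orth_decomp[OF u, of x] by simp
  qed
qed

section \<open>Block representations\<close>

lemma cline_eq: "norm u = 1 \<Longrightarrow> x \<in> cline u \<Longrightarrow> x = cinner x u *\<^sub>C u"
  by (auto simp: cline_def cinner_scaleC_left cinner_unit)

lemma block12_apply:
  "norm u = 1 \<Longrightarrow> S \<in> selfadjoint_op UNIV \<Longrightarrow> y \<in> uperp u \<Longrightarrow>
    block12 u S y = cinner y (S u) *\<^sub>C u"
  by (simp add: block12_def compression_def orth_proj_cline selfadjoint_sym)

lemma block22_apply: "y \<in> uperp u \<Longrightarrow> block22 u S y = orth_proj (uperp u) (S y)"
  by (simp add: block22_def compression_def)

lemma block12_cong: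
  assumes "norm u = 1" "S \<in> selfadjoint_op UNIV" "T \<in> selfadjoint_op UNIV" "S u = T u"
  shows "block12 u S = block12 u T"
proof
  show "block12 u S y = block12 u T y" for y
  proof (cases "y \<in> uperp u")
    case True
    then show ?thesis using assms by (simp add: block12_apply)
  next
    case False
    then show ?thesis by (simp add: block12_def compression_def)
  qed
qed

lemma block12_bounded:
  assumes u: "norm u = 1" and S: "S \<in> selfadjoint_op UNIV"
  shows "block12 u S \<in> bounded_op (uperp u) (cline u)"
proof -
  obtain K where K: "\<And>x. norm (S x) \<le> K * norm x"
    using selfadjoint_bounded[OF S] by auto
  have "norm (block12 u S y) \<le> K * norm y" if "y \<in> uperp u" for y
    using that norm_components_le(1)[OF u, of "S y"] K[of y]
    by (simp add: block12_def compression_def orth_proj_cline[OF u])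
  moreover have "x + y \<in> uperp u" "c *\<^sub>C x \<in> uperp u" if "x \<in> uperp u" "y \<in> uperp u" for x y c
    using that by (simp_all add: mem_uperp cinner_linear)
  moreover have "orth_proj (cline u) x \<in> cline u" for x
    unfolding orth_proj_cline[OF u] by (simp add: cline_def)
  then have "block12 u S \<in> uperp u \<rightarrow>\<^sub>E cline u"
    by (simp add: block12_def compression_def)
  ultimately show ?thesis
    unfolding bounded_op_def
    by (auto simp: block12_apply[OF u S] cinner_linear cscale.scale_left_distrib)
qed

lemma block22_selfadjoint:
  assumes u: "norm u = 1" and S: "S \<in> selfadjoint_op UNIV"
  shows "block22 u S \<in> selfadjoint_op (uperp u)"
proof -
  obtain K where K: "\<And>x. norm (S x) \<le> K * norm x"
    using selfadjoint_bounded[OF S] by auto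
  have lin: "x + y \<in> uperp u" "c *\<^sub>C x \<in> uperp u" if "x \<in> uperp u" "y \<in> uperp u" for x y c
    using that by (simp_all add: mem_uperp cinner_linear)
  show ?thesis
  proof (rule selfadjointI)
    show "norm (block22 u S y) \<le> K * norm y" if "y \<in> uperp u" for y
      using that norm_components_le(2)[OF u, of "S y"] K[of y] by (simp add: block22_apply)
  qed (use S in \<open>simp_all add: block22_apply lin orth_proj_uperp_mem[OF u]
      selfadjoint_add selfadjoint_scaleC orth_proj_uperp_add[OF u] orth_proj_uperp_scaleC[OF u]
      cinner_orth_proj_left[OF u] cinner_orth_proj_right[OF u] selfadjoint_sym,
      simp add: block22_def compression_def\<close>)
qed

lemma qform_block22: "norm u = 1 \<Longrightarrow> y \<in> uperp u \<Longrightarrow> qform (block22 u S) y = qform S y"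
  by (simp add: qform_def block22_apply cinner_orth_proj_left)

text \<open>
  An operator \<open>y \<mapsto> (y, d) u\<close> has the adjoint \<open>c u \<mapsto> c P d\<close>, where \<open>P\<close> projects onto the
  complement of \<open>u\<close>.
\<close>

lemma adjoint_rank_one:
  assumes u: "norm u = 1" and T: "\<And>y. y \<in> uperp u \<Longrightarrow> T y = cinner y d *\<^sub>C u"
  shows "adjoint_op (uperp u) (cline u) T (c *\<^sub>C u) = c *\<^sub>C orth_proj (uperp u) d"
proof (rule adjoint_op_eqI)
  show "c *\<^sub>C orth_proj (uperp u) d \<in> uperp u"
    using orth_proj_uperp_mem[OF u, of d] by (simp add: mem_uperp cinner_scaleC_left)
  show "c *\<^sub>C u \<in> cline u"
    by (simp add: cline_def)
  show "cinner (T y) (c *\<^sub>C u) = cinner y (c *\<^sub>C orth_proj (uperp u) d)" if "y \<in> uperp u" for y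
    using that by (simp add: T cinner_linear cinner_unit[OF u] cinner_orth_proj_right[OF u])
qed (rule uperp_diff)

lemma block_matrix_of_blocks:
  assumes u: "norm u = 1" and S: "S \<in> selfadjoint_op UNIV"
  shows "block_matrix u (qform S u) (block12 u S) (block22 u S) = S"
proof
  fix x
  let ?c = "cinner x u" and ?y = "orth_proj (uperp u) x"
  have y: "?y \<in> uperp u"
    using u by (rule orth_proj_uperp_mem)
  have "block_matrix u (qform S u) (block12 u S) (block22 u S) x =
      qform S u *\<^sub>R ?c *\<^sub>C u + cinner (S ?y) u *\<^sub>C u
      + (?c *\<^sub>C orth_proj (uperp u) (S u) + orth_proj (uperp u) (S ?y))"
    using adjoint_rank_one[OF u block12_apply[OF u S]]
    by (simp add: block_matrix_def Let_def orth_proj_cline[OF u] block12_apply[OF u S y]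
        block22_apply[OF y] selfadjoint_sym[OF S])
  also have "qform S u *\<^sub>R ?c *\<^sub>C u = ?c *\<^sub>C cinner (S u) u *\<^sub>C u"
    by (simp add: scaleR_scaleC selfadjoint_cinner_diag[OF S] mult.commute)
  also have "?c *\<^sub>C cinner (S u) u *\<^sub>C u + cinner (S ?y) u *\<^sub>C u
      + (?c *\<^sub>C orth_proj (uperp u) (S u) + orth_proj (uperp u) (S ?y))
      = ?c *\<^sub>C (cinner (S u) u *\<^sub>C u + orth_proj (uperp u) (S u))
      + (cinner (S ?y) u *\<^sub>C u + orth_proj (uperp u) (S ?y))"
    by (simp add: cscale.scale_right_distrib)
  also have "\<dots> = ?c *\<^sub>C S u + S ?y"
    by (simp only: orth_decomp[OF u, symmetric])
  also have "\<dots> = S x"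
    using arg_cong[OF orth_decomp[OF u, of x], of S]
    by (simp add: selfadjoint_add[OF S] selfadjoint_scaleC[OF S])
  finally show "block_matrix u (qform S u) (block12 u S) (block22 u S) x = S x" .
qed

text \<open>
  Self-adjointness of the whole matrix is what makes the adjoint in its lower left corner a
  genuine one: \<open>(T y, u) = (S y, u) = (y, S u)\<close> exhibits a representing vector for \<open>T\<close>.
\<close>

lemma blocks_of_block_matrix:
  assumes u: "norm u = 1" and T: "T \<in> bounded_op (uperp u) (cline u)"
    and S2: "S2 \<in> selfadjoint_op (uperp u)"
    and S: "block_matrix u s T S2 \<in> selfadjoint_op UNIV"
  shows "qform (block_matrix u s T S2) u = s"
    and "block12 u (block_matrix u s T S2) = T"
    and "block22 u (block_matrix u s T S2) = S2"
proof -
  let ?S = "block_matrix u s T S2"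
  have T_mem: "T y \<in> cline u" if "y \<in> uperp u" for y
    using T that by (auto simp: bounded_op_def)
  have T_undefined: "T y = undefined" if "y \<notin> uperp u" for y
    using T that unfolding bounded_op_def by (blast dest: PiE_arb)
  have zero: "0 \<in> uperp u"
    by (simp add: mem_uperp)
  have S2_0: "S2 0 = 0"
    using selfadjoint_scaleC[OF S2 zero, of 0] by simp
  have T_0: "T 0 = 0"
  proof -
    have "T (0 *\<^sub>C 0) = 0 *\<^sub>C T 0"
      using T zero by (auto simp: bounded_op_def)
    then show ?thesis by simp
  qed
  have "0 \<in> cline u"
    using cscale.scale_zero_left[of u] by (metis cline_def rangeI)
  then have adj_0: "adjoint_op (uperp u) (cline u) T 0 = 0"
    by (intro adjoint_op_eqI) (simp_all add: zero uperp_diff)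
  have S_perp: "?S y = T y + S2 y" if "y \<in> uperp u" for y
    using that u by (simp add: block_matrix_def orth_proj_cline orth_proj_uperp mem_uperp adj_0)
  have corner: "cinner (?S y) u *\<^sub>C u = T y" if y: "y \<in> uperp u" for y
    using selfadjoint_mem[OF S2 y] cline_eq[OF u T_mem[OF y]] S_perp[OF y]
    by (simp add: mem_uperp cinner_add_left)
  show "block12 u ?S = T"
  proof
    show "block12 u ?S y = T y" for y
    proof (cases "y \<in> uperp u")
      case True
      then show ?thesis
        by (simp add: block12_def compression_def orth_proj_cline[OF u] corner)
    next
      case False
      then show ?thesis
        by (simp add: block12_def compression_def T_undefined)
    qed
  qed
  show "block22 u ?S = S2"
  proof
    show "block22 u ?S y = S2 y" for y
    proof (cases "y \<in> uperp u")
      case True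
      then show ?thesis
        by (simp add: block22_apply orth_proj_uperp[OF u] corner) (simp add: S_perp)
    next
      case False
      then show ?thesis
        by (simp add: block22_def compression_def selfadjoint_undefined[OF S2])
    qed
  qed
  have "T y = cinner y (?S u) *\<^sub>C u" if "y \<in> uperp u" for y
    using corner[OF that] selfadjoint_sym[OF S, of y u] by simp
  then have "adjoint_op (uperp u) (cline u) T (1 *\<^sub>C u) = 1 *\<^sub>C orth_proj (uperp u) (?S u)"
    by (rule adjoint_rank_one[OF u])
  then have "?S u = s *\<^sub>R u + orth_proj (uperp u) (?S u)"
    using u by (subst block_matrix_def)
      (simp add: orth_proj_cline cinner_unit orth_proj_uperp T_0 S2_0)
  then have "cinner (?S u) u = cinner (s *\<^sub>R u + orth_proj (uperp u) (?S u)) u"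
    by simp
  also have "\<dots> = complex_of_real s"
    using orth_proj_uperp_mem[OF u, of "?S u"]
    by (simp add: mem_uperp cinner_linear scaleR_scaleC cinner_unit[OF u])
  finally show "qform ?S u = s"
    by (simp add: qform_def)
qed

lemma eq_if_block22_eq:
  assumes "norm u = 1" "S \<in> selfadjoint_op UNIV" "T \<in> selfadjoint_op UNIV" "S u = T u"
    and "block22 u S = block22 u T"
  shows "S = T"
proof -
  have "qform S u = qform T u"
    using assms(4) by (simp add: qform_def)
  then show ?thesis
    using block_matrix_of_blocks[OF assms(1,2)] block_matrix_of_blocks[OF assms(1,3)]
      block12_cong[OF assms(1-4)] assms(5) by metis
qed

text \<open>
  The lower right block of \<open>S\<close> can be exchanged at will; the witness is
  \<open>S + P (N - S\<^sub>2) P\<close> with \<open>P\<close> the projection onto the complement of \<open>u\<close>.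
\<close>

lemma block22_lift:
  assumes u: "norm u = 1" and S: "S \<in> selfadjoint_op UNIV"
    and N: "N \<in> selfadjoint_op (uperp u)"
  obtains L where "L \<in> selfadjoint_op UNIV" "L u = S u" "block22 u L = N"
proof
  let ?P = "orth_proj (uperp u)"
  let ?S2 = "block22 u S"
  define L where "L = (\<lambda>x. S x - ?S2 (?P x) + N (?P x))"
  note S2 = block22_selfadjoint[OF u S]
  note P = orth_proj_uperp_mem[OF u]
  obtain K1 where K1: "\<And>x. norm (S x) \<le> K1 * norm x"
    using selfadjoint_bounded[OF S] by auto
  obtain K2 where K2: "\<And>y. y \<in> uperp u \<Longrightarrow> norm (?S2 y) \<le> K2 * norm y"
    using selfadjoint_bounded[OF S2] by auto
  obtain K3 where K3: "\<And>y. y \<in> uperp u \<Longrightarrow> norm (N y) \<le> K3 * norm y"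
    using selfadjoint_bounded[OF N] by auto
  have sym: "cinner (R (?P x)) y = cinner x (R (?P y))" if R: "R \<in> selfadjoint_op (uperp u)" for R x y
    using selfadjoint_sym[OF R P[of x] P[of y]] selfadjoint_mem[OF R P[of x]]
      selfadjoint_mem[OF R P[of y]] cinner_orth_proj_left[OF u] cinner_orth_proj_right[OF u]
    by metis
  show "L \<in> selfadjoint_op UNIV"
  proof (rule selfadjointI)
    fix x
    let ?p = "norm (?P x)"
    have "K2 * ?p \<le> \<bar>K2\<bar> * norm x" "K3 * ?p \<le> \<bar>K3\<bar> * norm x"
      using norm_components_le(2)[OF u, of x] by (intro mult_mono; simp)+
    then have "norm (?S2 (?P x)) \<le> \<bar>K2\<bar> * norm x" "norm (N (?P x)) \<le> \<bar>K3\<bar> * norm x"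
      using K2[OF P[of x]] K3[OF P[of x]] by linarith+
    then show "norm (L x) \<le> (K1 + \<bar>K2\<bar> + \<bar>K3\<bar>) * norm x"
      using K1[of x] norm_triangle_ineq[of "S x - ?S2 (?P x)" "N (?P x)"]
        norm_triangle_ineq4[of "S x" "?S2 (?P x)"]
      by (simp add: L_def distrib_right)
  next
    show "L (c *\<^sub>C x) = c *\<^sub>C L x" for c x
      by (simp add: L_def orth_proj_uperp_scaleC[OF u] selfadjoint_scaleC[OF S]
          selfadjoint_scaleC[OF S2] selfadjoint_scaleC[OF N] P
          cscale.scale_right_diff_distrib cscale.scale_right_distrib)
  next
    show "cinner (L x) y = cinner x (L y)" for x y
      by (simp add: L_def cinner_linear sym[OF S2] sym[OF N] selfadjoint_sym[OF S])
  qed (simp_all add: L_def orth_proj_uperp_add[OF u] selfadjoint_add[OF S]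
      selfadjoint_add[OF S2] selfadjoint_add[OF N] P)
  have "?P u = 0"
    using u by (simp add: orth_proj_uperp cinner_unit)
  moreover have "?S2 0 = 0" "N 0 = 0"
    using selfadjoint_scaleC[OF S2, of 0 0] selfadjoint_scaleC[OF N, of 0 0]
    by (simp_all add: mem_uperp)
  ultimately show "L u = S u"
    by (simp add: L_def)
  show "block22 u L = N"
  proof
    show "block22 u L y = N y" for y
    proof (cases "y \<in> uperp u")
      case True
      then have "?S2 y = S y - cinner (S y) u *\<^sub>C u"
        by (simp add: block22_apply orth_proj_uperp[OF u])
      then have "L y = cinner (S y) u *\<^sub>C u + N y"
        using True by (simp add: L_def orth_proj_uperp_id[OF u])
      then show ?thesis
        using True selfadjoint_mem[OF N True]
        by (simp add: block22_apply orth_proj_uperp[OF u] mem_uperp cinner_linear cinner_unit[OF u])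
    next
      case False
      then show ?thesis
        by (simp add: block22_def compression_def selfadjoint_undefined[OF N])
    qed
  qed
qed

section \<open>The order on lower right blocks\<close>

text \<open>
  The difference has first column \<open>0\<close>, so its form depends only on the component orthogonal
  to \<open>u\<close>.
\<close>

lemma loewner_le_iff_block22:
  assumes u: "norm u = 1" and S: "S \<in> selfadjoint_op UNIV" and T: "T \<in> selfadjoint_op UNIV"
    and eq: "S u = T u"
  shows "loewner_le UNIV S T \<longleftrightarrow> loewner_le (uperp u) (block22 u S) (block22 u T)"
proof -
  let ?E = "\<lambda>x. T x - S x"
  have "qform ?E u = 0"
    using eq by (simp add: qform_def)
  then show ?thesis
    using positive_iff_schur[OF u selfadjoint_diff[OF T S]] eq
    by (simp add: qform_diff loewner_le_def qform_block22[OF u])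
qed

lemma schur_family_form:
  assumes u: "norm u = 1" and A: "A \<in> selfadjoint_op UNIV" and B: "B \<in> selfadjoint_op UNIV"
    and y: "y \<in> uperp u"
    and D: "D = restrict (\<lambda>x. block12 u A x - block12 u B x) (uperp u)"
  shows "qform (restrict (\<lambda>x. block22 u A x -
      t *\<^sub>R adjoint_op (uperp u) (cline u) D (D x)) (uperp u)) y =
    qform A y - t * (cmod (cinner y (A u - B u)))\<^sup>2"
proof -
  let ?d = "A u - B u"
  have Dy: "D x = cinner x ?d *\<^sub>C u" if "x \<in> uperp u" for x
    using that by (simp add: D block12_apply[OF u A] block12_apply[OF u B] cinner_diff_right
        cscale.scale_left_diff_distrib)
  have "adjoint_op (uperp u) (cline u) D (D y) = cinner y ?d *\<^sub>C orth_proj (uperp u) ?d"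
    using adjoint_rank_one[OF u Dy] by (simp add: Dy[OF y])
  moreover have "cinner (cinner y ?d *\<^sub>C orth_proj (uperp u) ?d) y
      = complex_of_real ((cmod (cinner y ?d))\<^sup>2)"
    using cinner_commute[of ?d y]
    by (simp only: cinner_scaleC_left cinner_orth_proj_left[OF u y] complex_norm_square)
  ultimately have "cinner (t *\<^sub>R adjoint_op (uperp u) (cline u) D (D y)) y
      = complex_of_real (t * (cmod (cinner y ?d))\<^sup>2)"
    by (simp only: scaleR_scaleC cinner_scaleC_left of_real_mult)
  then show ?thesis
    unfolding qform_def restrict_apply'[OF y] cinner_diff_left block22_apply[OF y]
      cinner_orth_proj_left[OF u y]
    by (simp only: minus_complex.sel Re_complex_of_real cinner_diff_right)
qed

text \<open>
  \<open>positive_iff_schur\<close> is applied to \<open>A - L\<close>, whose first column \<open>A u - B u\<close> does not depend on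
  \<open>L\<close>.
\<close>

lemma lower_bound_iff_block22:
  assumes u: "norm u = 1" and MM: "\<MM> \<subseteq> selfadjoint_op UNIV"
    and bdd: "\<And>A. A \<in> \<MM> \<Longrightarrow> qinf \<MM> u \<le> qform A u"
    and column: "\<And>A. A \<in> attaining \<MM> u \<Longrightarrow> A u = B u"
    and B: "B \<in> attaining \<MM> u"
    and L: "L \<in> selfadjoint_op UNIV" and Lu: "L u = B u"
  shows "L \<in> lower_bounds UNIV \<MM> \<longleftrightarrow>
    block22 u L \<in> lower_bounds (uperp u) (schur_family \<MM> u B)"
proof -
  have Bsa: "B \<in> selfadjoint_op UNIV" and B\<alpha>: "qform B u = qinf \<MM> u"
    using B MM by (auto simp: attaining_def)
  then have L\<alpha>: "qform L u = qinf \<MM> u"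
    using Lu by (simp add: qform_def)
  have le_iff: "loewner_le UNIV L A \<longleftrightarrow>
      (\<forall>y\<in>uperp u. qform (block22 u L) y \<le>
        qform A y - sharp (qform A u - qinf \<MM> u) * (cmod (cinner y (A u - B u)))\<^sup>2)"
    if A: "A \<in> \<MM>" for A
  proof -
    have Asa: "A \<in> selfadjoint_op UNIV"
      using A MM by blast
    let ?E = "\<lambda>x. A x - L x"
    have e: "qform ?E u = qform A u - qinf \<MM> u"
      by (simp add: qform_diff L\<alpha>)
    have "?E u = 0" if "qform ?E u = 0"
      using that e A column[of A] Lu by (simp add: attaining_def)
    then have "(\<forall>x. 0 \<le> qform ?E x) \<longleftrightarrow>
      (\<forall>y\<in>uperp u. sharp (qform ?E u) * (cmod (cinner y (?E u)))\<^sup>2 \<le> qform ?E y)"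
      using e bdd[OF A] by (intro positive_iff_schur[OF u selfadjoint_diff[OF Asa L]]) auto
    then show ?thesis
      unfolding e by (simp add: loewner_le_def qform_diff Lu qform_block22[OF u] algebra_simps)
  qed
  have "(\<forall>A\<in>\<MM>. loewner_le UNIV L A) \<longleftrightarrow>
      (\<forall>S\<in>schur_family \<MM> u B. loewner_le (uperp u) (block22 u L) S)"
    unfolding schur_family_def Let_def ball_simps(9)
  proof (rule ball_cong[OF refl])
    fix A assume A: "A \<in> \<MM>"
    then have Asa: "A \<in> selfadjoint_op UNIV"
      using MM by blast
    then show "loewner_le UNIV L A \<longleftrightarrow> loewner_le (uperp u) (block22 u L)
        (restrict (\<lambda>x. block22 u A x - sharp (qform A u - qinf \<MM> u) *\<^sub>R
          adjoint_op (uperp u) (cline u)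
            (restrict (\<lambda>x. block12 u A x - block12 u B x) (uperp u))
            (restrict (\<lambda>x. block12 u A x - block12 u B x) (uperp u) x)) (uperp u))"
      unfolding le_iff[OF A] unfolding loewner_le_def
      by (intro ball_cong refl) (simp only: schur_family_form[OF u Asa Bsa _ refl])
  qed
  then show ?thesis
    using L block22_selfadjoint[OF u L] by (simp add: lower_bounds_def)
qed

lemma lower_bound_attaining_column:
  assumes L: "L \<in> lower_bounds UNIV \<MM>" and MM: "\<MM> \<subseteq> selfadjoint_op UNIV"
    and B: "B \<in> \<MM>" and eq: "qform L u = qform B u"
  shows "L u = B u"
proof -
  have "(\<lambda>x. B x - L x) \<in> selfadjoint_op UNIV"
    using L B MM by (intro selfadjoint_diff) (auto simp: lower_bounds_def)
  moreover have "0 \<le> qform (\<lambda>x. B x - L x) x" for x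
    using L B by (simp add: lower_bounds_def loewner_le_def qform_diff)
  ultimately have "B u - L u = 0"
    by (rule positive_form_zero) (simp add: qform_diff eq)
  then show ?thesis
    by simp
qed

lemma maximal_attaining_iff:
  assumes bdd: "\<And>L. L \<in> lower_bounds UNIV \<MM> \<Longrightarrow> qform L u \<le> qinf \<MM> u"
  shows "is_maximal UNIV (lower_bounds_attaining \<MM> u) M \<longleftrightarrow>
    is_maximal UNIV (lower_bounds UNIV \<MM>) M \<and> qform M u = qinf \<MM> u"
proof -
  have "L \<in> lower_bounds_attaining \<MM> u"
    if "L \<in> lower_bounds UNIV \<MM>" "loewner_le UNIV M L" "qform M u = qinf \<MM> u" for L
  proof -
    have "qform M u \<le> qform L u"
      using that(2) by (simp add: loewner_le_def)
    then show ?thesis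
      using that bdd[of L] by (simp add: lower_bounds_attaining_def)
  qed
  then show ?thesis
    by (auto simp: is_maximal_def lower_bounds_attaining_def)
qed

section \<open>Maximal lower bounds\<close>

theorem corollary4p12:
  fixes \<MM> :: "('a::complex_hilbert_space \<Rightarrow> 'a) set"
    and u :: 'a
    and B M :: "'a \<Rightarrow> 'a"
  assumes "\<MM> \<subseteq> selfadjoint_op UNIV"
    and "\<MM> \<noteq> {}"
    and "lower_bounds UNIV \<MM> \<noteq> {}"
    and "norm u = 1"
    and "attaining \<MM> u \<noteq> {}"
    and "\<forall>A\<in>attaining \<MM> u. \<forall>A'\<in>attaining \<MM> u. A u = A' u"
    and "B \<in> attaining \<MM> u"
    and "M \<in> lower_bounds UNIV \<MM>"
  shows "(\<forall>B'\<in>attaining \<MM> u. schur_family \<MM> u B' = schur_family \<MM> u B) \<and>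
    (is_maximal UNIV (lower_bounds_attaining \<MM> u) M \<longleftrightarrow>
       is_maximal UNIV (lower_bounds UNIV \<MM>) M \<and> qform M u = qinf \<MM> u) \<and>
    (is_maximal UNIV (lower_bounds UNIV \<MM>) M \<and> qform M u = qinf \<MM> u \<longleftrightarrow>
       (\<exists>B12\<in>bounded_op (uperp u) (cline u).
        \<exists>B2\<in>selfadjoint_op (uperp u).
        \<exists>M2\<in>selfadjoint_op (uperp u).
          block_matrix u (qinf \<MM> u) B12 B2 \<in> attaining \<MM> u \<and>
          M = block_matrix u (qinf \<MM> u) B12 M2 \<and>
          is_maximal (uperp u) (lower_bounds (uperp u) (schur_family \<MM> u B)) M2))"
proof -
  let ?\<alpha> = "qinf \<MM> u"
  note MM = assms(1) and u = assms(4) and B = assms(7) and M = assms(8)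
  have B_mem: "B \<in> \<MM>" and B\<alpha>: "qform B u = ?\<alpha>"
    using B by (auto simp: attaining_def)
  have Bsa: "B \<in> selfadjoint_op UNIV" and Msa: "M \<in> selfadjoint_op UNIV"
    using B_mem MM M by (auto simp: lower_bounds_def)
  have column: "A u = B u" if "A \<in> attaining \<MM> u" for A
    using assms(6) that B by blast
  have bdd: "?\<alpha> \<le> qform A u" if "A \<in> \<MM>" for A
    unfolding qinf_def
  proof (rule cINF_lower[OF _ that])
    show "bdd_below ((\<lambda>A. qform A u) ` \<MM>)"
      using M by (intro bdd_belowI2[of _ "qform M u"]) (auto simp: lower_bounds_def loewner_le_def)
  qed
  have le\<alpha>: "qform L u \<le> ?\<alpha>" if "L \<in> lower_bounds UNIV \<MM>" for L
    using that B_mem unfolding lower_bounds_def loewner_le_def B\<alpha>[symmetric] by blast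
  have lb_column: "L u = B u" if "L \<in> lower_bounds_attaining \<MM> u" for L
    using that lower_bound_attaining_column[OF _ MM B_mem] B\<alpha>
    by (simp add: lower_bounds_attaining_def)
  let ?L2 = "lower_bounds (uperp u) (schur_family \<MM> u B)"
  have in_Lu: "L \<in> lower_bounds_attaining \<MM> u \<longleftrightarrow> block22 u L \<in> ?L2"
    if "L \<in> selfadjoint_op UNIV" "L u = B u" for L
  proof -
    have "L \<in> lower_bounds UNIV \<MM> \<longleftrightarrow> block22 u L \<in> ?L2"
      by (rule lower_bound_iff_block22[OF u MM]) (use bdd column B that in blast)+
    then show ?thesis
      using that(2) B\<alpha> by (simp add: lower_bounds_attaining_def qform_def)
  qed
  have Lu_sa: "L \<in> selfadjoint_op UNIV" if "L \<in> lower_bounds_attaining \<MM> u" for L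
    using that by (simp add: lower_bounds_attaining_def lower_bounds_def)

  have family: "schur_family \<MM> u B' = schur_family \<MM> u B" if B': "B' \<in> attaining \<MM> u" for B'
  proof -
    have "B' \<in> selfadjoint_op UNIV"
      using B' MM by (auto simp: attaining_def)
    then have "block12 u B' = block12 u B"
      using block12_cong[OF u _ Bsa] column[OF B'] by blast
    then show ?thesis
      by (simp add: schur_family_def)
  qed

  have maximal_iff: "is_maximal UNIV (lower_bounds_attaining \<MM> u) M \<longleftrightarrow>
      is_maximal (uperp u) ?L2 (block22 u M)" if Mu: "M u = B u"
  proof
    assume max: "is_maximal UNIV (lower_bounds_attaining \<MM> u) M"
    have "N = block22 u M" if N: "N \<in> ?L2" "loewner_le (uperp u) (block22 u M) N" for N
    proof -
      obtain L where L: "L \<in> selfadjoint_op UNIV" "L u = B u" "block22 u L = N"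
        using block22_lift[OF u Bsa] N(1) by (auto simp: lower_bounds_def)
      then have "L \<in> lower_bounds_attaining \<MM> u" "loewner_le UNIV M L"
        using in_Lu[of L] N loewner_le_iff_block22[OF u Msa L(1)] Mu by auto
      then show ?thesis
        using max L(3) by (auto simp: is_maximal_def)
    qed
    then show "is_maximal (uperp u) ?L2 (block22 u M)"
      using max in_Lu[OF Msa Mu] by (auto simp: is_maximal_def)
  next
    assume max: "is_maximal (uperp u) ?L2 (block22 u M)"
    have "L = M" if L: "L \<in> lower_bounds_attaining \<MM> u" "loewner_le UNIV M L" for L
    proof -
      note Lsa = Lu_sa[OF L(1)] and Lu = lb_column[OF L(1)]
      have "block22 u L \<in> ?L2" "loewner_le (uperp u) (block22 u M) (block22 u L)"
        using in_Lu[OF Lsa Lu] L loewner_le_iff_block22[OF u Msa Lsa] Mu Lu by auto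
      then show ?thesis
        using max eq_if_block22_eq[OF u Lsa Msa] Lu Mu by (auto simp: is_maximal_def)
    qed
    then show "is_maximal UNIV (lower_bounds_attaining \<MM> u) M"
      using max in_Lu[OF Msa Mu] by (auto simp: is_maximal_def)
  qed

  have "is_maximal UNIV (lower_bounds_attaining \<MM> u) M \<longleftrightarrow>
      (\<exists>B12\<in>bounded_op (uperp u) (cline u).
        \<exists>B2\<in>selfadjoint_op (uperp u).
        \<exists>M2\<in>selfadjoint_op (uperp u).
          block_matrix u ?\<alpha> B12 B2 \<in> attaining \<MM> u \<and>
          M = block_matrix u ?\<alpha> B12 M2 \<and> is_maximal (uperp u) ?L2 M2)"
    (is "?max \<longleftrightarrow> ?blocks")
  proof
    assume max: ?max
    then have Mem: "M \<in> lower_bounds_attaining \<MM> u"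
      by (simp add: is_maximal_def)
    note Mu = lb_column[OF Mem]
    have "block_matrix u ?\<alpha> (block12 u B) (block22 u B) = B"
      using block_matrix_of_blocks[OF u Bsa] B\<alpha> by simp
    moreover have "M = block_matrix u ?\<alpha> (block12 u B) (block22 u M)"
      using block_matrix_of_blocks[OF u Msa] block12_cong[OF u Msa Bsa Mu] Mem
      by (simp add: lower_bounds_attaining_def)
    ultimately show ?blocks
      using B max maximal_iff[OF Mu] block12_bounded[OF u Bsa] block22_selfadjoint[OF u Bsa]
        block22_selfadjoint[OF u Msa] by metis
  next
    assume ?blocks
    then obtain B12 M2 where B12: "B12 \<in> bounded_op (uperp u) (cline u)"
      and M2: "M2 \<in> selfadjoint_op (uperp u)" and M_eq: "M = block_matrix u ?\<alpha> B12 M2"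
      and max: "is_maximal (uperp u) ?L2 M2"
      by blast
    have "qform M u = ?\<alpha>" "block22 u M = M2"
      using blocks_of_block_matrix[OF u B12 M2] Msa M_eq by auto
    then show ?max
      using max maximal_iff lb_column M by (simp add: lower_bounds_attaining_def)
  qed
  then show ?thesis
    using family maximal_attaining_iff[OF le\<alpha>] by blast
qed

end
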